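(* Let $Q$ be a precoherent semimultiplicative lattice with identity element $1$ such that every compact element of $Q$ is residuated and $x \wedge 1$ exists for all $x \in Q$, and let $\star$ be a nucleus on $Q$. For any $x \in Q$ let $x^{\overline{\star}} = \bigvee\{x/z : z \in Q,\ z \le 1,\ z^\star = 1^\star\}$. Then $\overline{\star}$ is the largest stable nucleus on $Q$ that is smaller than $\star$. Moreover, the following conditions on $\star$ are equivalent. (1) $\star$ is stable. (2) $(x\wedge 1)^\star = x^\star \wedge 1^\star$ and $(x/t)^\star = x^\star/t$ for all $x,t \in Q$ with $t$ compact. (3) $(x/t \wedge 1)^\star = x^\star/t \wedge 1^\star$ for all $x,t \in Q$ with $t$ compact. (4) $\star = \overline{\star}$.
   Context: An ordered magma is a set with a binary operation and a partial order such that $x\le x'$, $y \le y'$ imply $xy \le x'y'$. A semimultiplicative lattice is a commutative, associative, unital ordered magma $Q$ (identity $1$) such that $\bigvee X$ exists and $a(\bigvee X) = \bigvee(aX)$ for every $a\in Q$ and every nonempty $X \subseteq Q$ that is finite or bounded above. A directed subset is a nonempty subset $\Delta$ in which every finite subset has an upper bound in $\Delta$. An element $x$ of a poset $S$ is compact if, whenever $x \le \bigvee\Delta$ for a directed $\Delta\subseteq S$ for which $\bigvee\Delta$ exists, one has $x \le y$ for some $y \in \Delta$. An ordered magma is precoherent if every element is the supremum of a set of compact elements and the set of compact elements is closed under multiplication. For $x,a\in Q$, $x/a$ denotes the largest $z \in Q$ with $za \le x$, if it exists; $a$ is residuated if $x/a$ exists for all $x \in Q$. A closure operation on a poset is a self-map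 $\star: x\mapsto x^\star$ that is expansive, order-preserving and idempotent; a nucleus on $Q$ is a closure operation $\star$ with $x^\star y^\star \le (xy)^\star$ for all $x,y$. For a nucleus $\star$ on $Q$, every $z\in Q$ with $z\le 1$ and $z^\star = 1^\star$ is residuated and the set of elements $x/z$ for such $z$ is bounded above by $x^\star$, so $x^{\overline\star}$ is well defined. A nucleus $\star$ on $Q$ is stable if $(\bigwedge X)^\star = \bigwedge(X^\star)$ for every finite subset $X$ of $Q$ such that $\bigwedge X$ exists (where $X^\star = \{x^\star:x\in X\}$) and $(x/t)^\star = x^\star/t$ for all $x,t\in Q$ with $t$ compact such that $x/t$ exists. Equations involving infima assert that the infima exist and equality holds. Nuclei are compared pointwise; "smaller" means $\le$ pointwise, not necessarily strictly. *)

theory Defs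
  imports Main
begin

text \<open>
  Suprema and infima are partial: \<open>is_lub X s\<close> says that the supremum of \<open>X\<close> exists and equals
  \<open>s\<close>, and likewise for \<open>is_glb\<close> and (below) \<open>is_residual\<close>. The operators \<open>lub\<close>, \<open>glb\<close> and
  \<open>residual\<close> are meaningful only when the element they describe exists.
\<close>

context order
begin

definition is_lub :: "'a set \<Rightarrow> 'a \<Rightarrow> bool" where
  "is_lub X s \<longleftrightarrow> (\<forall>x\<in>X. x \<le> s) \<and> (\<forall>u. (\<forall>x\<in>X. x \<le> u) \<longrightarrow> s \<le> u)"

definition is_glb :: "'a set \<Rightarrow> 'a \<Rightarrow> bool" where
  "is_glb X m \<longleftrightarrow> (\<forall>x\<in>X. m \<le> x) \<and> (\<forall>l. (\<forall>x\<in>X. l \<le> x) \<longrightarrow> l \<le> m)"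

definition lub :: "'a set \<Rightarrow> 'a" where
  "lub X = (THE s. is_lub X s)"

definition glb :: "'a set \<Rightarrow> 'a" where
  "glb X = (THE m. is_glb X m)"

lemma lub_eqI: "is_lub X s \<Longrightarrow> lub X = s"
  unfolding lub_def by (rule the_equality) (auto simp: is_lub_def intro: order.antisym)

lemma glb_eqI: "is_glb X m \<Longrightarrow> glb X = m"
  unfolding glb_def by (rule the_equality) (auto simp: is_glb_def intro: order.antisym)

end

definition directed :: "'a::order set \<Rightarrow> bool" where
  "directed D \<longleftrightarrow> D \<noteq> {} \<and> (\<forall>F. finite F \<and> F \<subseteq> D \<longrightarrow> (\<exists>u\<in>D. \<forall>x\<in>F. x \<le> u))"

definition compact_element :: "'a::order \<Rightarrow> bool" where
  "compact_element x \<longleftrightarrow>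
    (\<forall>D s. directed D \<and> is_lub D s \<and> x \<le> s \<longrightarrow> (\<exists>y\<in>D. x \<le> y))"

definition closure_operation :: "('a::order \<Rightarrow> 'a) \<Rightarrow> bool" where
  "closure_operation c \<longleftrightarrow> (\<forall>x. x \<le> c x) \<and> mono c \<and> (\<forall>x. c (c x) = c x)"

class ordered_magma = times + order +
  assumes times_mono: "x \<le> x' \<Longrightarrow> y \<le> y' \<Longrightarrow> x * y \<le> x' * y'"

class semimultiplicative_lattice = ordered_magma + comm_monoid_mult +
  assumes is_lub_ex: "X \<noteq> {} \<Longrightarrow> finite X \<or> bdd_above X \<Longrightarrow> \<exists>s. is_lub X s"
    and times_is_lub: "X \<noteq> {} \<Longrightarrow> finite X \<or> bdd_above X \<Longrightarrow> is_lub X s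
      \<Longrightarrow> is_lub ((\<lambda>x. a * x) ` X) (a * s)"

text \<open>The elements of \<^typ>\<open>'a\<close> are those of the magma, so the property is one of the type.\<close>

definition precoherent :: "'a::ordered_magma itself \<Rightarrow> bool" where
  "precoherent _ \<longleftrightarrow>
    (\<forall>x::'a. \<exists>K. (\<forall>k\<in>K. compact_element k) \<and> is_lub K x) \<and>
    (\<forall>x y::'a. compact_element x \<and> compact_element y \<longrightarrow> compact_element (x * y))"

definition is_residual :: "'a::semimultiplicative_lattice \<Rightarrow> 'a \<Rightarrow> 'a \<Rightarrow> bool" where
  "is_residual x a r \<longleftrightarrow> r * a \<le> x \<and> (\<forall>z. z * a \<le> x \<longrightarrow> z \<le> r)"

definition residual :: "'a::semimultiplicative_lattice \<Rightarrow> 'a \<Rightarrow> 'a" where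
  "residual x a = (THE r. is_residual x a r)"

definition residuated :: "'a::semimultiplicative_lattice \<Rightarrow> bool" where
  "residuated a \<longleftrightarrow> (\<forall>x. \<exists>r. is_residual x a r)"

definition nucleus :: "('a::semimultiplicative_lattice \<Rightarrow> 'a) \<Rightarrow> bool" where
  "nucleus c \<longleftrightarrow> closure_operation c \<and> (\<forall>x y. c x * c y \<le> c (x * y))"

text \<open>
  The last two clauses assert existence on the right-hand side. The set \<open>X\<close> may be empty, in which case
  \<open>m\<close> is the greatest element.
\<close>

definition stable_nucleus :: "('a::semimultiplicative_lattice \<Rightarrow> 'a) \<Rightarrow> bool" where
  "stable_nucleus c \<longleftrightarrow> nucleus c \<and>
    (\<forall>X m. finite X \<and> is_glb X m \<longrightarrow> is_glb (c ` X) (c m)) \<and>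
    (\<forall>x t r. compact_element t \<and> is_residual x t r \<longrightarrow> is_residual (c x) t (c r))"

definition stabilization ::
    "('a::semimultiplicative_lattice \<Rightarrow> 'a) \<Rightarrow> 'a \<Rightarrow> 'a" where
  "stabilization c x = lub {residual x z |z. z \<le> 1 \<and> c z = c 1}"

lemma residual_eqI: "is_residual x a r \<Longrightarrow> residual x a = r"
  unfolding residual_def
  by (rule the_equality) (auto intro: order_antisym simp: is_residual_def)

lemma is_residual_residual: "is_residual x a r \<Longrightarrow> is_residual x a (residual x a)"
  by (simp add: residual_eqI)

text \<open>The residuals and the supremum in the definition of \<^const>\<open>stabilization\<close> exist.\<close>

lemma nucleus_residual_bound:
  assumes "nucleus c" "c z = c 1" "w * z \<le> x"
  shows "w \<le> c x"
proof -
  have exp: "y \<le> c y" and mono: "mono c" and sub: "c u * c v \<le> c (u * v)" for y u v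
    using assms(1) by (auto simp: nucleus_def closure_operation_def)
  have "w * 1 \<le> c w * c 1" by (intro times_mono exp)
  also have "\<dots> = c w * c z" by (simp add: assms(2))
  also have "\<dots> \<le> c (w * z)" by (rule sub)
  also have "\<dots> \<le> c x" by (rule monoD[OF mono assms(3)])
  finally show ?thesis by simp
qed

lemma nucleus_residuated:
  assumes "nucleus c" "z \<le> 1" "c z = c 1"
  shows "residuated z"
  unfolding residuated_def
proof
  fix x
  let ?W = "{w. w * z \<le> x}"
  have "x * z \<le> x * 1" using assms(2) by (intro times_mono) auto
  then have ne: "?W \<noteq> {}" by auto
  have bdd: "bdd_above ?W"
    using nucleus_residual_bound[OF assms(1,3)] by (auto intro!: bdd_aboveI[of _ "c x"])
  obtain s where s: "is_lub ?W s" using is_lub_ex[OF ne] bdd by blast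
  have "is_lub ((\<lambda>w. z * w) ` ?W) (z * s)" using times_is_lub[OF ne _ s] bdd by blast
  then have "z * s \<le> x"
    by (auto simp: is_lub_def mult.commute)
  moreover have "w \<le> s" if "w * z \<le> x" for w using s that by (simp add: is_lub_def)
  ultimately show "\<exists>r. is_residual x z r"
    by (auto simp: is_residual_def mult.commute)
qed

lemma is_lub_stabilization:
  assumes "nucleus c"
  shows "is_lub {residual x z |z. z \<le> 1 \<and> c z = c 1} (stabilization c x)"
    (is "is_lub ?R _")
proof -
  have "residual x 1 \<in> ?R" by auto
  then have ne: "?R \<noteq> {}" by blast
  have "residual x z \<le> c x" if "z \<le> 1" "c z = c 1" for z
  proof -
    have "is_residual x z (residual x z)"
      using nucleus_residuated[OF assms that] is_residual_residual by (auto simp: residuated_def)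
    then show ?thesis
      using nucleus_residual_bound[OF assms that(2)] by (auto simp: is_residual_def)
  qed
  then have "bdd_above ?R" by (auto intro!: bdd_aboveI[of _ "c x"])
  then obtain s where "is_lub ?R s" using is_lub_ex[OF ne] by blast
  then show ?thesis by (simp add: stabilization_def lub_eqI)
qed

end

theory Submission
  imports Defs
begin

text \<open>
  For compact \<open>t\<close>, directedness of the family \<open>x/z\<close> gives \<open>t \<le> x\<^bsup>bar\<^esup>\<close> iff \<open>t z \<le> x\<close> for some
  \<open>z \<le> 1\<close> with \<open>z\<^sup>\<star> = 1\<^sup>\<star>\<close>, and the best candidate for \<open>z\<close> is \<open>x/t \<and> 1\<close>; hence \<open>t \<le> x\<^bsup>bar\<^esup>\<close> iff
  \<open>1 \<le> (x/t \<and> 1)\<^sup>\<star>\<close>. As every element is determined by the compact elements below it, all claims reduce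
  to this criterion.
\<close>

section \<open>Infima, residuals, compact elements and directed sets\<close>

lemma is_glb_pairD:
  fixes a b m :: "'a::order"
  assumes "is_glb {a, b} m"
  shows "m \<le> a" "m \<le> b" "l \<le> a \<Longrightarrow> l \<le> b \<Longrightarrow> l \<le> m"
  using assms by (auto simp: is_glb_def)

lemma le_residual_iff:
  assumes "residuated a"
  shows "z \<le> residual x a \<longleftrightarrow> z * a \<le> x"
proof -
  have r: "is_residual x a (residual x a)"
    using assms is_residual_residual by (auto simp: residuated_def)
  have "z * a \<le> residual x a * a" if "z \<le> residual x a"
    using that by (intro times_mono) auto
  with r show ?thesis
    unfolding is_residual_def using order_trans by metis
qed

lemma le_if_compact_le:
  fixes x y :: "'a::ordered_magma"
  assumes "precoherent TYPE('a)" "\<And>t. compact_element t \<Longrightarrow> t \<le> x \<Longrightarrow> t \<le> y"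
  shows "x \<le> y"
proof -
  obtain K where "\<forall>k\<in>K. compact_element k" "is_lub K x"
    using assms(1) unfolding precoherent_def by blast
  with assms(2) show ?thesis by (auto simp: is_lub_def)
qed

lemma directed_binaryI:
  fixes D :: "'a::order set"
  assumes "D \<noteq> {}" "\<And>x y. x \<in> D \<Longrightarrow> y \<in> D \<Longrightarrow> \<exists>u\<in>D. x \<le> u \<and> y \<le> u"
  shows "directed D"
  unfolding directed_def
proof (intro conjI allI impI; (elim conjE)?)
  fix F assume "finite F" "F \<subseteq> D"
  then show "\<exists>u\<in>D. \<forall>x\<in>F. x \<le> u"
  proof (induction F rule: finite_induct)
    case empty
    then show ?case using assms(1) by auto
  next
    case (insert x F)
    then obtain u where "u \<in> D" "\<forall>y\<in>F. y \<le> u" by auto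
    moreover then obtain v where "v \<in> D" "x \<le> v" "u \<le> v"
      using assms(2)[of x u] insert.prems by auto
    ultimately show ?case using order_trans[of _ u v] by auto
  qed
qed (rule assms(1))

section \<open>Closure properties of a nucleus and its dense elements\<close>

context
  fixes c :: "'a::semimultiplicative_lattice \<Rightarrow> 'a"
  assumes nuc: "nucleus c"
begin

lemma nucleus_expansive: "x \<le> c x"
  and nucleus_mono: "x \<le> y \<Longrightarrow> c x \<le> c y"
  and nucleus_idem: "c (c x) = c x"
  and nucleus_times: "c x * c y \<le> c (x * y)"
  using nuc by (simp_all add: nucleus_def closure_operation_def mono_def)

lemma nucleus_le_iff: "c x \<le> c y \<longleftrightarrow> x \<le> c y"
  by (metis nucleus_expansive nucleus_mono nucleus_idem order_trans)

text \<open>The index set in the definition of \<open>stabilization\<close>. Its closure under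
  products yields both the directedness of the residuals and the product inequality for
  \<open>stabilization\<close>.\<close>

definition dense_elements :: "'a set" where
  "dense_elements = {z. z \<le> 1 \<and> c z = c 1}"

lemma dense_elements_one: "1 \<in> dense_elements"
  by (simp add: dense_elements_def)

text \<open>For \<open>z \<le> 1\<close> monotonicity already gives \<open>c z \<le> c 1\<close>;
  the reverse inequality amounts to \<open>1 \<le> c z\<close> by
  \<open>nucleus_le_iff\<close>.\<close>

lemma dense_elements_iff: "z \<in> dense_elements \<longleftrightarrow> z \<le> 1 \<and> 1 \<le> c z"
  unfolding dense_elements_def
  using nucleus_expansive[of 1] nucleus_le_iff[of 1 z] nucleus_mono[of z 1]
  by (auto intro: order_antisym)

lemma dense_elements_times:
  assumes "z \<in> dense_elements" "w \<in> dense_elements"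
  shows "z * w \<in> dense_elements"
proof -
  have "z * w \<le> 1 * 1" "1 * 1 \<le> c z * c w"
    using assms by (intro times_mono; simp add: dense_elements_iff)+
  then show ?thesis
    using nucleus_times[of z w] by (auto simp: dense_elements_iff)
qed

lemma dense_elements_residuated: "z \<in> dense_elements \<Longrightarrow> residuated z"
  by (intro nucleus_residuated[OF nuc]) (auto simp: dense_elements_def)

section \<open>The stabilization as a directed supremum of residuals by dense elements\<close>

lemma is_lub_stabilization_dense:
  "is_lub ((\<lambda>z. residual x z) ` dense_elements) (stabilization c x)"
  using is_lub_stabilization[OF nuc, of x]
  by (simp add: dense_elements_def setcompr_eq_image)

text \<open>Together with \<open>stabilization_leI\<close> this describes the supremum through pairs
  with \<open>w * z \<le> x\<close>, so that later arguments multiply inequalities instead of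
  handling residuals.\<close>

lemma le_stabilizationI: "z \<in> dense_elements \<Longrightarrow> w * z \<le> x \<Longrightarrow> w \<le> stabilization c x"
  using is_lub_stabilization_dense[of x] le_residual_iff[OF dense_elements_residuated, of z w x]
    order_trans[of w "residual x z"]
  by (simp add: is_lub_def)

lemma stabilization_leI:
  "(\<And>w z. z \<in> dense_elements \<Longrightarrow> w * z \<le> x \<Longrightarrow> w \<le> y) \<Longrightarrow> stabilization c x \<le> y"
  using is_lub_stabilization_dense[of x] le_residual_iff[OF dense_elements_residuated, of _ _ x]
    order_refl
  unfolding is_lub_def by blast

lemma stabilization_le: "stabilization c x \<le> c x"
  by (rule stabilization_leI, rule nucleus_residual_bound[OF nuc])
    (auto simp: dense_elements_def)

lemma stabilization_expansive: "x \<le> stabilization c x"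
  using le_stabilizationI[OF dense_elements_one] by simp

lemma stabilization_mono: "x \<le> y \<Longrightarrow> stabilization c x \<le> stabilization c y"
  by (rule stabilization_leI) (rule le_stabilizationI, assumption, rule order_trans)

text \<open>Multiplication distributes over the defining suprema, so the two factors can be replaced
  in turn by some \<open>w\<close> and \<open>v\<close> with \<open>w * z \<le> x\<close> and
  \<open>v * z' \<le> y\<close>. The dense element \<open>z * z'\<close> then witnesses the bound
  for \<open>w * v\<close>.\<close>

lemma stabilization_times:
  "stabilization c x * stabilization c y \<le> stabilization c (x * y)"
proof -
  have one_sided: "w * stabilization c y \<le> u"
    if "\<And>v z. z \<in> dense_elements \<Longrightarrow> v * z \<le> y \<Longrightarrow> w * v \<le> u" for w y u
  proof -
    let ?R = "(\<lambda>z. residual y z) ` dense_elements"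
    \<comment> \<open>Distributivity applies: the family is nonempty because \<open>1\<close> is
      dense, and it is bounded above by its own supremum.\<close>
    have "is_lub ((\<lambda>v. w * v) ` ?R) (w * stabilization c y)"
      using is_lub_stabilization_dense[of y] dense_elements_one
      by (intro times_is_lub) (auto simp: is_lub_def intro: bdd_aboveI)
    moreover have "w * v \<le> u" if "v \<in> ?R" for v
      using that \<open>\<And>v z. z \<in> dense_elements \<Longrightarrow> v * z \<le> y \<Longrightarrow> w * v \<le> u\<close>
        le_residual_iff[OF dense_elements_residuated] by blast
    ultimately show ?thesis by (auto simp: is_lub_def)
  qed
  have pair: "w * v \<le> stabilization c (x * y)"
    if "z \<in> dense_elements" "w * z \<le> x" "z' \<in> dense_elements" "v * z' \<le> y" for w v z z'
  proof (rule le_stabilizationI)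
    show "z * z' \<in> dense_elements" using that by (intro dense_elements_times)
    show "w * v * (z * z') \<le> x * y"
      using times_mono[OF that(2,4)] by (simp add: ac_simps)
  qed
  have "w * stabilization c y \<le> stabilization c (x * y)"
    if "z \<in> dense_elements" "w * z \<le> x" for w z
    by (rule one_sided, rule pair[OF that])
  \<comment> \<open>The second use of \<open>one_sided\<close> expands the other factor, which
    commutativity moves to the right.\<close>
  then have "stabilization c y * stabilization c x \<le> stabilization c (x * y)"
    by (intro one_sided) (simp add: mult.commute)
  then show ?thesis by (simp add: mult.commute)
qed

text \<open>Both \<open>residual x z\<close> and \<open>residual x w\<close> lie below
  \<open>residual x (z * w)\<close>, because dense elements are at most \<open>1\<close> and closed
  under products.\<close>

lemma directed_residuals: "directed ((\<lambda>z. residual x z) ` dense_elements)"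
proof (rule directed_binaryI)
  have le: "residual x z \<le> residual x (z * w)"
    if "z \<in> dense_elements" "w \<in> dense_elements" for z w
  proof -
    have "residual x z * z * w \<le> x * 1"
      using that le_residual_iff[OF dense_elements_residuated]
      by (intro times_mono) (auto simp: dense_elements_def)
    then show ?thesis
      using that le_residual_iff[OF dense_elements_residuated[OF dense_elements_times]]
      by (simp add: mult.assoc)
  qed
  fix a b
  assume "a \<in> (\<lambda>z. residual x z) ` dense_elements" "b \<in> (\<lambda>z. residual x z) ` dense_elements"
  then obtain z w where zw: "z \<in> dense_elements" "w \<in> dense_elements"
    and ab: "a = residual x z" "b = residual x w"
    by blast
  show "\<exists>u\<in>(\<lambda>z. residual x z) ` dense_elements. a \<le> u \<and> b \<le> u"
    using le[OF zw] le[OF zw(2,1)] dense_elements_times[OF zw]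
    by (auto simp: ab mult.commute)
qed (use dense_elements_one in auto)

lemma compact_le_stabilization_iff:
  assumes "compact_element t"
  shows "t \<le> stabilization c x \<longleftrightarrow> (\<exists>z\<in>dense_elements. t * z \<le> x)"
proof
  assume "t \<le> stabilization c x"
  then obtain z where "z \<in> dense_elements" "t \<le> residual x z"
    using assms directed_residuals is_lub_stabilization_dense
    unfolding compact_element_def by blast
  then show "\<exists>z\<in>dense_elements. t * z \<le> x"
    using le_residual_iff[OF dense_elements_residuated] by blast
qed (blast intro: le_stabilizationI)

section \<open>The stabilization is a stable nucleus\<close>

context
  assumes precoh: "precoherent TYPE('a)"
    and compact_residuated: "compact_element (t::'a) \<Longrightarrow> residuated t"
    and glb_one_ex: "\<exists>m. is_glb {x::'a, 1} m"
begin

lemma is_glb_glb_one: "is_glb {x::'a, 1} (glb {x, 1})"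
  using glb_one_ex[of x] glb_eqI by metis

lemma compact_times: "compact_element s \<Longrightarrow> compact_element t \<Longrightarrow> compact_element (s * t :: 'a)"
  using precoh by (simp add: precoherent_def)

text \<open>The infimum dominates every dense \<open>z\<close> with \<open>t * z \<le> x\<close>, so
  it is itself dense as soon as one such \<open>z\<close> exists. A search for a witness thus
  becomes a single inequality, which can be proved by approximation from below.\<close>

lemma compact_le_stabilization_iff_glb:
  assumes "compact_element t"
  shows "t \<le> stabilization c x \<longleftrightarrow> 1 \<le> c (glb {residual x t, 1})"
proof -
  let ?m = "glb {residual x t, 1}"
  note m = is_glb_pairD[OF is_glb_glb_one[of "residual x t"]]
  have le_iff: "w \<le> residual x t \<longleftrightarrow> t * w \<le> x" for w
    using le_residual_iff[OF compact_residuated[OF assms]] by (simp add: mult.commute)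
  show ?thesis
  proof
    assume "t \<le> stabilization c x"
    then obtain z where "z \<in> dense_elements" "t * z \<le> x"
      using compact_le_stabilization_iff[OF assms] by blast
    then have "1 \<le> c z" "c z \<le> c ?m"
      using m(3) le_iff by (auto simp: dense_elements_iff intro!: nucleus_mono)
    then show "1 \<le> c ?m" by (rule order_trans)
  next
    assume "1 \<le> c ?m"
    then have "?m \<in> dense_elements" using m by (simp add: dense_elements_iff)
    then show "t \<le> stabilization c x"
      using compact_le_stabilization_iff[OF assms] m(1) le_iff by blast
  qed
qed

text \<open>The dense \<open>z\<close> with \<open>t * z \<le> stabilization c x\<close> may fail to
  be compact, so the witness criterion cannot be applied to \<open>t * z\<close>. It is applied to
  \<open>t * k\<close> for compact \<open>k \<le> z\<close> instead.\<close>

lemma stabilization_idem: "stabilization c (stabilization c x) = stabilization c x"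
proof (rule order_antisym)
  show "stabilization c (stabilization c x) \<le> stabilization c x"
  proof (rule le_if_compact_le[OF precoh])
    fix t assume t: "compact_element t" "t \<le> stabilization c (stabilization c x)"
    then obtain z where z: "z \<in> dense_elements" "t * z \<le> stabilization c x"
      using compact_le_stabilization_iff by blast
    let ?m = "glb {residual x t, 1}"
    have "z \<le> c ?m"
    proof (rule le_if_compact_le[OF precoh])
      fix k assume k: "compact_element k" "k \<le> z"
      have "t * k \<le> t * z" using k by (intro times_mono) auto
      then have "t * k \<le> stabilization c x" using z by (auto intro: order_trans)
      \<comment> \<open>This \<open>z'\<close> depends on \<open>k\<close>, so no common witness
        results. The bound \<open>k \<le> c ?m\<close> is independent of \<open>z'\<close>, however,
        and passes to the supremum \<open>z\<close> of all such \<open>k\<close>.\<close>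
      then obtain z' where z': "z' \<in> dense_elements" "t * k * z' \<le> x"
        using compact_le_stabilization_iff compact_times t k by blast
      have "k * z' \<le> 1 * 1"
        using k z z' by (intro times_mono) (auto simp: dense_elements_def)
      moreover have "k * z' \<le> residual x t"
        using z' le_residual_iff[OF compact_residuated[OF t(1)]] by (simp add: ac_simps)
      ultimately have "k * z' \<le> ?m"
        using is_glb_pairD(3)[OF is_glb_glb_one] by simp
      have "k * 1 \<le> c k * c z'"
        using z' by (intro times_mono nucleus_expansive) (simp add: dense_elements_iff)
      also have "\<dots> \<le> c (k * z')" by (rule nucleus_times)
      also have "\<dots> \<le> c ?m" using \<open>k * z' \<le> ?m\<close> by (rule nucleus_mono)
      finally show "k \<le> c ?m" by simp
    qed
    then have "c z \<le> c ?m" by (simp add: nucleus_le_iff)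
    then have "1 \<le> c ?m" using z by (auto simp: dense_elements_iff intro: order_trans)
    then show "t \<le> stabilization c x"
      using compact_le_stabilization_iff_glb t by blast
  qed
qed (rule stabilization_expansive)

lemma stabilization_nucleus: "nucleus (stabilization c)"
  unfolding nucleus_def closure_operation_def
  by (simp add: stabilization_expansive stabilization_mono stabilization_idem
      stabilization_times monoI)

text \<open>A compact \<open>t\<close> below all \<open>stabilization c x\<close> has one dense
  witness for each \<open>x\<close> in \<open>X\<close>. The product of these finitely many
  witnesses serves all of \<open>X\<close> at once, since each factor is at most \<open>1\<close>;
  for empty \<open>X\<close> it is \<open>1\<close>.\<close>

lemma stabilization_is_glb:
  assumes "finite X" "is_glb X m"
  shows "is_glb (stabilization c ` X) (stabilization c m)"
  unfolding is_glb_def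
proof (intro conjI allI impI)
  show "\<forall>y\<in>stabilization c ` X. stabilization c m \<le> y"
    using assms(2) by (auto simp: is_glb_def intro: stabilization_mono)
next
  fix l assume l: "\<forall>y\<in>stabilization c ` X. l \<le> y"
  show "l \<le> stabilization c m"
  proof (rule le_if_compact_le[OF precoh])
    fix t assume t: "compact_element t" "t \<le> l"
    have "\<forall>x\<in>X. t \<le> stabilization c x" using l t by (auto intro: order_trans)
    with assms(1) have "\<exists>z\<in>dense_elements. \<forall>x\<in>X. t * z \<le> x"
    proof (induction X rule: finite_induct)
      case empty
      then show ?case using dense_elements_one by auto
    next
      case (insert x X)
      then obtain z where z: "z \<in> dense_elements" "\<forall>y\<in>X. t * z \<le> y" by auto
      obtain w where w: "w \<in> dense_elements" "t * w \<le> x"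
        using insert.prems compact_le_stabilization_iff[OF t(1)] by auto
      have "t * (z * w) \<le> t * z" "t * (z * w) \<le> t * w"
        using z w times_mono[of z z w 1] times_mono[of z 1 w w]
        by (auto simp: dense_elements_def intro!: times_mono)
      then show ?case
        using z w dense_elements_times[of z w] by (intro bexI[of _ "z * w"]) (auto intro: order_trans)
    qed
    then show "t \<le> stabilization c m"
      using assms(2) compact_le_stabilization_iff[OF t(1)] by (auto simp: is_glb_def)
  qed
qed

text \<open>The product inequality gives one half. For maximality, a compact \<open>u\<close> below
  \<open>w\<close> makes \<open>u * t\<close> compact, and a dense \<open>z\<close> with
  \<open>u * t * z \<le> x\<close> satisfies \<open>u * z \<le> r\<close>.\<close>

lemma stabilization_is_residual:
  assumes "compact_element t" "is_residual x t r"
  shows "is_residual (stabilization c x) t (stabilization c r)"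
  unfolding is_residual_def
proof (intro conjI allI impI)
  have "stabilization c r * t \<le> stabilization c r * stabilization c t"
    by (intro times_mono stabilization_expansive) simp
  also have "\<dots> \<le> stabilization c (r * t)" by (rule stabilization_times)
  also have "\<dots> \<le> stabilization c x"
    using assms(2) by (intro stabilization_mono) (simp add: is_residual_def)
  finally show "stabilization c r * t \<le> stabilization c x" .
next
  fix w assume w: "w * t \<le> stabilization c x"
  show "w \<le> stabilization c r"
  proof (rule le_if_compact_le[OF precoh])
    fix u assume u: "compact_element u" "u \<le> w"
    have "u * t \<le> w * t" using u by (intro times_mono) auto
    then have "u * t \<le> stabilization c x" using w by (rule order_trans)
    then obtain z where z: "z \<in> dense_elements" "u * t * z \<le> x"
      using compact_le_stabilization_iff compact_times u(1) assms(1) by blast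
    then have "u * z \<le> r" using assms(2) by (simp add: is_residual_def ac_simps)
    with z show "u \<le> stabilization c r" by (blast intro: le_stabilizationI)
  qed
qed

lemma stabilization_stable: "stable_nucleus (stabilization c)"
  unfolding stable_nucleus_def
  using stabilization_nucleus stabilization_is_glb stabilization_is_residual by blast

section \<open>Maximality among stable nuclei below \<open>c\<close>\<close>

lemma stable_residual:
  assumes "stable_nucleus d" "compact_element t"
  shows "d (residual x t) = residual (d x) (t::'a)"
proof -
  have "is_residual x t (residual x t)"
    using compact_residuated[OF assms(2)] is_residual_residual by (auto simp: residuated_def)
  then show ?thesis
    using assms by (metis residual_eqI stable_nucleus_def)
qed

lemma stable_glb_one:
  assumes "stable_nucleus d"
  shows "is_glb {d (x::'a), d 1} (d (glb {x, 1}))"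
proof -
  have "is_glb (d ` {x, 1}) (d (glb {x, 1}))"
    using assms is_glb_glb_one[of x] unfolding stable_nucleus_def by blast
  then show ?thesis by simp
qed

text \<open>If \<open>t \<le> d x\<close>, then \<open>1\<close> is below both
  \<open>residual (d x) t\<close> and \<open>d 1\<close>, hence below their infimum, which
  \<open>d \<le> c\<close> carries into the compact criterion. The form covers a stable
  \<open>d\<close> as well as \<open>star\<close> itself under \<open>cond3\<close>.\<close>

lemma le_stabilization_if_residual_glb:
  assumes "d \<le> c" "\<And>x. x \<le> d x"
    and glb: "\<And>x t. compact_element t \<Longrightarrow>
      is_glb {residual (d x) t, d 1} (d (glb {residual x t, 1}))"
  shows "d \<le> stabilization c"
proof (rule le_funI, rule le_if_compact_le[OF precoh])
  fix x t assume t: "compact_element t" "t \<le> d x"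
  then have "1 \<le> residual (d x) t"
    by (simp add: le_residual_iff compact_residuated)
  then have "1 \<le> d (glb {residual x t, 1})"
    by (rule is_glb_pairD(3)[OF glb[OF t(1)]]) (rule assms(2))
  also have "\<dots> \<le> c (glb {residual x t, 1})" using assms(1) by (rule le_funD)
  finally show "t \<le> stabilization c x"
    using compact_le_stabilization_iff_glb[OF t(1)] by blast
qed

lemma stable_le_stabilization:
  assumes "stable_nucleus d" "d \<le> c"
  shows "d \<le> stabilization c"
proof (rule le_stabilization_if_residual_glb[OF assms(2)])
  show "x \<le> d x" for x
    using assms(1) by (auto simp: stable_nucleus_def nucleus_def closure_operation_def)
  show "is_glb {residual (d x) t, d 1} (d (glb {residual x t, 1}))" if "compact_element t" for x t
    using stable_glb_one[OF assms(1), of "residual x t"] stable_residual[OF assms(1) that] by simp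
qed

end

end

theorem theorem7p3:
  fixes star :: "'a::semimultiplicative_lattice \<Rightarrow> 'a"
  assumes "precoherent TYPE('a)"
    and "\<forall>t::'a. compact_element t \<longrightarrow> residuated t"
    and "\<forall>x::'a. \<exists>m. is_glb {x, 1} m"
    and "nucleus star"
  defines "cond1 \<equiv> stable_nucleus star"
    and "cond2 \<equiv> (\<forall>x. is_glb {star x, star 1} (star (glb {x, 1}))) \<and>
        (\<forall>x t. compact_element t \<longrightarrow> star (residual x t) = residual (star x) t)"
    and "cond3 \<equiv> (\<forall>x t. compact_element t \<longrightarrow>
        is_glb {residual (star x) t, star 1} (star (glb {residual x t, 1})))"
    and "cond4 \<equiv> star = stabilization star"
  shows "(stable_nucleus (stabilization star) \<and>
          stabilization star \<le> star \<and>
          (\<forall>c. stable_nucleus c \<and> c \<le> star \<longrightarrow> c \<le> stabilization star)) \<and>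
         (cond1 \<longleftrightarrow> cond2) \<and> (cond1 \<longleftrightarrow> cond3) \<and> (cond1 \<longleftrightarrow> cond4)"
proof -
  note hyps = assms(4,1) assms(2)[rule_format] assms(3)[rule_format]
  have stable: "stable_nucleus (stabilization star)"
    by (rule stabilization_stable[OF hyps])
  have below: "stabilization star \<le> star"
    by (intro le_funI stabilization_le assms(4))
  have largest: "c \<le> stabilization star" if "stable_nucleus c" "c \<le> star" for c
    by (rule stable_le_stabilization[OF hyps that])
  \<comment> \<open>The equivalences follow from the cycle \<open>cond1\<close>,
    \<open>cond2\<close>, \<open>cond3\<close>, \<open>cond4\<close>, \<open>cond1\<close>.\<close>
  have "cond2" if "cond1"
    using that unfolding cond1_def cond2_def
    by (auto intro: stable_glb_one[OF hyps] stable_residual[OF hyps])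
  \<comment> \<open>The infimum identity is taken at \<open>residual x t\<close>, and the residual
    identity then rewrites \<open>star (residual x t)\<close>.\<close>
  moreover have "cond3" if "cond2"
    using that unfolding cond2_def cond3_def by metis
  moreover have "cond4" if "cond3"
  proof -
    have "star \<le> stabilization star"
    proof (rule le_stabilization_if_residual_glb[OF hyps order_refl])
      show "x \<le> star x" for x
        by (rule nucleus_expansive[OF assms(4)])
      show "is_glb {residual (star x) t, star 1} (star (glb {residual x t, 1}))"
        if "compact_element t" for x t
        using \<open>cond3\<close> that unfolding cond3_def by simp
    qed
    with below show ?thesis unfolding cond4_def by (rule order_antisym[rotated])
  qed
  moreover have "cond1" if "cond4"
    using that stable unfolding cond1_def cond4_def by metis
  ultimately show ?thesis using stable below largest by blast
qed

end
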